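(* For every integer $d \geq 5$ with $d \neq 7$, the group $H_d$ is uncollapsed.
   Context: For a positive integer $n$, $H_n = \langle a,b,c \mid a^2,b^2,c^2,(ab)^3,(ac)^2,(bc)^n,(bac)^n\rangle$. For positive integers $m,n$ we write $H_m = H_n$ if the two presentations define the same quotient of the free group on $a,b,c$, i.e. the normal closures in the free group of the two sets of relators coincide. $H_d$ is called uncollapsed if $H_d \neq H_k$ for all integers $1 \leq k < d$. *)

theory Defs
  imports "HOL-Algebra.Coset"
begin

text \<open>
  The letter \<open>(x, True)\<close> stands for the generator \<open>x\<close> and \<open>(x, False)\<close> for its formal inverse.
\<close>

type_synonym 'g letter = "'g \<times> bool"

definition letter_inv :: "'g letter \<Rightarrow> 'g letter" where
  "letter_inv l = (fst l, \<not> snd l)"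

definition reduced :: "'g letter list \<Rightarrow> bool" where
  "reduced w \<longleftrightarrow> successively (\<lambda>l m. m \<noteq> letter_inv l) w"

fun red_cons :: "'g letter \<Rightarrow> 'g letter list \<Rightarrow> 'g letter list" where
  "red_cons l [] = [l]"
| "red_cons l (m # w) = (if m = letter_inv l then w else l # m # w)"

definition reduce :: "'g letter list \<Rightarrow> 'g letter list" where
  "reduce w = foldr red_cons w []"

definition free_group :: "'g letter list monoid" where
  "free_group = \<lparr>carrier = {w. reduced w}, mult = (\<lambda>v w. reduce (v @ w)), one = []\<rparr>"

definition free_gen :: "'g \<Rightarrow> 'g letter list" where
  "free_gen x = [(x, True)]"

definition normal_closure :: "('a, 'b) monoid_scheme \<Rightarrow> 'a set \<Rightarrow> 'a set" where
  "normal_closure G R = \<Inter>{N. N \<lhd> G \<and> R \<subseteq> N}"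

lemma letter_inv_inv [simp]: "letter_inv (letter_inv l) = l"
  by (simp add: letter_inv_def)

lemma letter_inv_neq [simp]: "letter_inv l \<noteq> l" "l \<noteq> letter_inv l"
  by (cases l; simp add: letter_inv_def)+

lemma reduced_Nil [simp]: "reduced []"
  by (simp add: reduced_def)

lemma reduced_Cons: "reduced (l # w) \<longleftrightarrow> (w = [] \<or> hd w \<noteq> letter_inv l) \<and> reduced w"
  by (auto simp: reduced_def successively_Cons)

lemma reduced_red_cons: "reduced w \<Longrightarrow> reduced (red_cons l w)"
  by (cases w) (auto simp: reduced_Cons)

lemma reduced_foldr: "reduced w \<Longrightarrow> reduced (foldr red_cons v w)"
  by (induction v) (auto simp: reduced_red_cons)

lemma reduced_reduce: "reduced (reduce w)"
  by (simp add: reduce_def reduced_foldr)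

lemma reduce_reduced: "reduced w \<Longrightarrow> reduce w = w"
proof (induction w)
  case (Cons l w)
  then show ?case by (cases w) (auto simp: reduce_def reduced_Cons)
qed (simp add: reduce_def)

lemma red_cons_cancel: "reduced w \<Longrightarrow> red_cons (letter_inv l) (red_cons l w) = w"
  by (cases w rule: list.exhaust; cases "tl w") (auto simp: reduced_Cons)

lemma red_cons_cancel': "reduced w \<Longrightarrow> red_cons l (red_cons (letter_inv l) w) = w"
  using red_cons_cancel[of w "letter_inv l"] by simp

lemma foldr_red_cons:
  "reduced y \<Longrightarrow> foldr red_cons (red_cons l w) y = red_cons l (foldr red_cons w y)"
  by (cases w) (auto simp: red_cons_cancel' reduced_foldr)

lemma foldr_reduce: "reduced y \<Longrightarrow> foldr red_cons (reduce w) y = foldr red_cons w y"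
  by (induction w) (auto simp: reduce_def foldr_red_cons)

lemma reduce_append_left: "reduce (reduce v @ w) = reduce (v @ w)"
  by (simp add: reduce_def foldr_reduce[unfolded reduce_def] reduced_foldr)

lemma reduce_append_right: "reduce (v @ reduce w) = reduce (v @ w)"
  using reduce_reduced[OF reduced_reduce, of w] by (simp add: reduce_def)

lemma reduce_inverse: "reduce (rev (map letter_inv w) @ w) = []"
proof -
  have "foldr red_cons (rev (map letter_inv w)) (foldr red_cons w y) = y" if "reduced y" for y
    using that by (induction w) (auto simp: red_cons_cancel reduced_foldr)
  from this[of "[]"] show ?thesis by (simp add: reduce_def)
qed

lemma group_free_group: "group (free_group :: 'g letter list monoid)"
proof (rule groupI)
  fix x :: "'g letter list" assume "x \<in> carrier free_group"
  show "\<exists>y\<in>carrier free_group. y \<otimes>\<^bsub>free_group\<^esub> x = \<one>\<^bsub>free_group\<^esub>"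
    by (rule bexI[of _ "reduce (rev (map letter_inv x))"])
      (auto simp: free_group_def reduce_append_left reduce_inverse reduced_reduce)
qed (auto simp: free_group_def reduced_reduce reduce_append_left reduce_append_right reduce_reduced)

lemma free_gen_closed [simp]: "free_gen x \<in> carrier free_group"
  by (simp add: free_group_def free_gen_def reduced_Cons)

lemma free_group_Cons:
  assumes "(x, e) # w \<in> carrier free_group"
  shows "w \<in> carrier free_group"
    and "(x, e) # w =
      (if e then free_gen x else inv\<^bsub>free_group\<^esub> free_gen x) \<otimes>\<^bsub>free_group\<^esub> w"
proof -
  interpret F: group "free_group :: 'a letter list monoid" by (rule group_free_group)
  show "w \<in> carrier free_group"
    using assms by (simp add: free_group_def reduced_Cons)
  have "inv\<^bsub>free_group\<^esub> free_gen x = [(x, False)]"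
    by (rule F.inv_equality)
      (auto simp: free_group_def free_gen_def reduced_Cons reduce_def letter_inv_def)
  then show "(x, e) # w =
      (if e then free_gen x else inv\<^bsub>free_group\<^esub> free_gen x) \<otimes>\<^bsub>free_group\<^esub> w"
    using assms reduce_reduced[of "(x, e) # w"]
    by (auto simp: free_group_def free_gen_def)
qed

lemma free_group_universal:
  fixes f :: "'g \<Rightarrow> 'a" and G :: "('a, 'b) monoid_scheme"
  assumes "group G" and f: "\<And>x. f x \<in> carrier G"
  shows "\<exists>h \<in> hom free_group G. (\<forall>x. h (free_gen x) = f x) \<and>
    (\<forall>h' \<in> hom free_group G. (\<forall>x. h' (free_gen x) = f x) \<longrightarrow>
      (\<forall>w \<in> carrier free_group. h' w = h w))"
proof -
  interpret G: group G by fact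
  interpret F: group "free_group :: 'g letter list monoid" by (rule group_free_group)
  define g where "g l = (if snd l then f (fst l) else inv\<^bsub>G\<^esub> f (fst l))" for l
  define h where "h w = foldr (\<lambda>l y. g l \<otimes>\<^bsub>G\<^esub> y) w \<one>\<^bsub>G\<^esub>" for w
  have g: "g l \<in> carrier G" for l by (simp add: g_def f)
  have g_inv: "g (letter_inv l) = inv\<^bsub>G\<^esub> g l" for l by (simp add: g_def letter_inv_def f)
  have h_simps: "h [] = \<one>\<^bsub>G\<^esub>" "h (l # w) = g l \<otimes>\<^bsub>G\<^esub> h w" for l w by (simp_all add: h_def)
  have h: "h w \<in> carrier G" for w by (induction w) (auto simp: h_simps g)
  have h_append: "h (v @ w) = h v \<otimes>\<^bsub>G\<^esub> h w" for v w
    by (induction v) (auto simp: h_simps g h G.m_assoc)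
  have h_red_cons: "h (red_cons l w) = g l \<otimes>\<^bsub>G\<^esub> h w" for l w
    by (cases w) (auto simp: h_simps g g_inv h G.m_assoc[symmetric])
  have h_reduce: "h (reduce w) = h w" for w
    by (induction w) (auto simp: reduce_def h_simps h_red_cons)
  show ?thesis
  proof (intro bexI[of _ h] conjI allI ballI impI)
    show "h \<in> hom free_group G"
      by (rule homI) (auto simp: h free_group_def h_reduce h_append)
    show "h (free_gen x) = f x" for x
      by (simp add: free_gen_def h_simps g_def f)
  next
    fix h' and w :: "'g letter list"
    assume h': "h' \<in> hom free_group G" "\<forall>x. h' (free_gen x) = f x" and w: "w \<in> carrier free_group"
    interpret h': group_hom free_group G h'
      using h' by (unfold_locales) auto
    from w show "h' w = h w"
    proof (induction w)
      case Nil
      then show ?case using h'.hom_one by (simp add: h_simps free_group_def)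
    next
      case (Cons l w)
      obtain x e where l: "l = (x, e)" by (cases l)
      have w: "w \<in> carrier free_group" using Cons.prems unfolding l by (rule free_group_Cons(1))
      have eq: "(x, e) # w = (if e then free_gen x else inv\<^bsub>free_group\<^esub> free_gen x) \<otimes>\<^bsub>free_group\<^esub> w"
        using Cons.prems unfolding l by (rule free_group_Cons(2))
      have "h' (l # w) = h' ((if e then free_gen x else inv\<^bsub>free_group\<^esub> free_gen x) \<otimes>\<^bsub>free_group\<^esub> w)"
        unfolding l by (rule arg_cong[OF eq])
      also have "\<dots> = g l \<otimes>\<^bsub>G\<^esub> h' w"
        using w h'(2) by (cases e) (simp_all add: l g_def)
      finally show ?case using Cons.IH[OF w] by (simp add: h_simps)
    qed
  qed
qed

datatype gen = Gen_a | Gen_b | Gen_c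

definition H_relators :: "nat \<Rightarrow> gen letter list set" where
  "H_relators n =
    (let F = free_group; a = free_gen Gen_a; b = free_gen Gen_b; c = free_gen Gen_c in
      {a [^]\<^bsub>F\<^esub> (2::nat), b [^]\<^bsub>F\<^esub> (2::nat), c [^]\<^bsub>F\<^esub> (2::nat),
       (a \<otimes>\<^bsub>F\<^esub> b) [^]\<^bsub>F\<^esub> (3::nat), (a \<otimes>\<^bsub>F\<^esub> c) [^]\<^bsub>F\<^esub> (2::nat),
       (b \<otimes>\<^bsub>F\<^esub> c) [^]\<^bsub>F\<^esub> n, (b \<otimes>\<^bsub>F\<^esub> a \<otimes>\<^bsub>F\<^esub> c) [^]\<^bsub>F\<^esub> n})"

definition H_group :: "nat \<Rightarrow> gen letter list set monoid" where
  "H_group n = free_group Mod normal_closure free_group (H_relators n)"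

text \<open>
  Equality of \<open>H_group m\<close> and \<open>H_group n\<close> is equality as quotients of the free group, not isomorphism.
\<close>

definition H_eq :: "nat \<Rightarrow> nat \<Rightarrow> bool" where
  "H_eq m n \<longleftrightarrow>
    normal_closure free_group (H_relators m) = normal_closure free_group (H_relators n)"

lemma H_eq_iff: "H_eq m n \<longleftrightarrow> H_group m = H_group n"
proof
  assume "H_group m = H_group n"
  then have "\<one>\<^bsub>H_group m\<^esub> = \<one>\<^bsub>H_group n\<^esub>" by simp
  then show "H_eq m n" by (simp add: H_group_def H_eq_def FactGroup_def)
qed (simp add: H_group_def H_eq_def)

definition H_uncollapsed :: "nat \<Rightarrow> bool" where
  "H_uncollapsed d \<longleftrightarrow> (\<forall>k. 1 \<le> k \<and> k < d \<longrightarrow> \<not> H_eq d k)"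

end

theory Submission
  imports Defs
begin

text \<open>
  Over \<open>\<int>/N\<close> with \<open>N = 2 x + 1\<close> there are three explicit matrices satisfying the relations of
  \<open>H\<^sub>d\<close> that do not involve \<open>d\<close>, such that \<open>bc\<close> and \<open>bac\<close> both have characteristic polynomial
  \<open>(X - 1) (X\<^sup>2 - x X + 1)\<close>. The \<open>d\<close>-th power of such a matrix is trivial iff \<open>N\<close> divides the
  \<open>d\<close>-th Lehmer number of the roots of \<open>2 X\<^sup>2 + X + 2\<close>. These numbers are units for
  \<open>d \<in> {1, 2, 3, 4, 7}\<close>, and a congruence modulo \<open>256 * 257\<close> shows that no other odd \<open>d\<close>
  gives a unit. Hence \<open>bc\<close> has order \<open>d\<close> in \<open>H\<^sub>d\<close> whenever \<open>d \<ge> 5\<close>, \<open>d \<noteq> 7\<close>, and \<open>d\<close> is minimal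
  with respect to divisibility among such numbers (the even ones being \<open>6\<close>, \<open>8\<close> and \<open>14\<close>).

  For a multiple \<open>m d\<close>, one passes to an extension by \<open>\<int>/m\<close>-valued functions: a cocycle that is
  trivial on the relators not involving \<open>d\<close> takes the value \<open>1\<close> on \<open>(bc)\<^sup>d\<close>, so that \<open>bc\<close> has order
  \<open>m d\<close> in \<open>H\<^bsub>m d\<^esub>\<close>.
\<close>

section \<open>Lehmer numbers of absolute value 1\<close>

text \<open>
  \<open>lehmer 1 k\<close> and \<open>lehmer 2 k\<close> are the Lehmer numbers of index \<open>2 k + 1\<close> and \<open>2 k + 2\<close> of the
  pair with \<open>(\<alpha> + \<beta>)\<^sup>2 = 3\<close> and \<open>\<alpha> \<beta> = 2\<close>.
\<close>

fun lehmer :: "nat \<Rightarrow> nat \<Rightarrow> int" where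
  "lehmer e 0 = 1"
| "lehmer e (Suc 0) = 3 - 2 * int e"
| "lehmer e (Suc (Suc k)) = - lehmer e (Suc k) - 4 * lehmer e k"

lemma odd_lehmer: "odd (lehmer e k)"
  by (induction e k rule: lehmer.induct) auto

text \<open>
  \<open>lehmer 1 k\<close> modulo \<open>65792 = 256 * 257\<close> has period \<open>256\<close> from \<open>k = 4\<close> on, starting with
  \<open>19\<close> and \<open>- 23\<close>.
\<close>

fun cycle_avoids_units :: "nat \<Rightarrow> int \<Rightarrow> int \<Rightarrow> bool" where
  "cycle_avoids_units 0 p q \<longleftrightarrow> p = 19 \<and> q = 65769"
| "cycle_avoids_units (Suc n) p q \<longleftrightarrow>
    p \<noteq> 1 \<and> p \<noteq> 65791 \<and> cycle_avoids_units n q ((- q - 4 * p) mod 65792)"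

lemma cycle_avoids_units_256: "cycle_avoids_units 256 19 65769"
  by code_simp

lemma cycle_avoids_units_lehmer:
  assumes "cycle_avoids_units n (lehmer e k mod 65792) (lehmer e (Suc k) mod 65792)"
  shows "i < n \<Longrightarrow> lehmer e (k + i) mod 65792 \<notin> {1, 65791}"
    and "lehmer e (k + n) mod 65792 = 19"
    and "lehmer e (Suc (k + n)) mod 65792 = 65769"
proof -
  have "(i < n \<longrightarrow> lehmer e (k + i) mod 65792 \<notin> {1, 65791}) \<and>
      lehmer e (k + n) mod 65792 = 19 \<and> lehmer e (Suc (k + n)) mod 65792 = 65769"
    using assms
  proof (induction n arbitrary: k i)
    case (Suc n)
    have "(- (lehmer e (Suc k) mod 65792) - 4 * (lehmer e k mod 65792)) mod 65792
        = lehmer e (Suc (Suc k)) mod 65792"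
      by (metis lehmer.simps(3) mod_diff_eq mod_minus_eq mod_mult_right_eq)
    with Suc.prems have *: "lehmer e k mod 65792 \<notin> {1, 65791}"
        "cycle_avoids_units n (lehmer e (Suc k) mod 65792) (lehmer e (Suc (Suc k)) mod 65792)"
      by simp_all
    show ?case
      using Suc.IH[OF *(2), of "i - 1"] *(1) by (cases i) auto
  qed simp
  then show "i < n \<Longrightarrow> lehmer e (k + i) mod 65792 \<notin> {1, 65791}"
    and "lehmer e (k + n) mod 65792 = 19"
    and "lehmer e (Suc (k + n)) mod 65792 = 65769"
    by blast+
qed

lemma abs_lehmer_1_gt_1:
  assumes "k \<ge> 2" "k \<noteq> 3"
  shows "\<bar>lehmer 1 k\<bar> > 1"
\<comment> \<open>\<open>k = 2\<close> lies before the periodic part; the excluded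
  \<open>k = 3\<close> is index \<open>7\<close>.\<close>
proof (cases "k = 2")
  case True
  then show ?thesis by (simp add: numeral_2_eq_2)
next
  case False
  have start: "lehmer 1 (4 + 256 * j) mod 65792 = 19 \<and> lehmer 1 (Suc (4 + 256 * j)) mod 65792 = 65769" for j
  proof (induction j)
    case 0
    show ?case by (simp add: eval_nat_numeral)
  next
    case (Suc j)
    then show ?case
      using cycle_avoids_units_lehmer(2,3)[of 256 1 "4 + 256 * j"] cycle_avoids_units_256
      by (simp add: algebra_simps)
  qed
  define i j where "i = (k - 4) mod 256" and "j = (k - 4) div 256"
  have "k = 4 + 256 * j + i"
    using False assms by (simp add: i_def j_def)
  moreover have "lehmer 1 (4 + 256 * j + i) mod 65792 \<notin> {1, 65791}"
    using start[of j] cycle_avoids_units_256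
    by (intro cycle_avoids_units_lehmer(1)[of 256]) (simp_all add: i_def)
  ultimately have "lehmer 1 k \<noteq> 1" "lehmer 1 k \<noteq> -1"
    by auto
  moreover have "lehmer 1 k \<noteq> 0"
    using odd_lehmer[of 1 k] by auto
  ultimately show ?thesis by linarith
qed

section \<open>Linear recurrences with characteristic polynomial
  \<open>(X - 1) (X^2 - y X + 1)\<close>\<close>

text \<open>
  With \<open>y = z + 1/z\<close>, this is \<open>(z\<^sup>n - 1) / (z\<^sup>k (z\<^sup>e - 1))\<close> for \<open>n = 2 k + e\<close> and \<open>e \<in> {1, 2}\<close>.
\<close>

fun dirichlet :: "nat \<Rightarrow> int \<Rightarrow> nat \<Rightarrow> int" where
  "dirichlet e y 0 = 1"
| "dirichlet e y (Suc 0) = y + 2 - int e"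
| "dirichlet e y (Suc (Suc k)) = y * dirichlet e y (Suc k) - dirichlet e y k"


text \<open>Modulo \<open>N\<close> one has \<open>2 y = - 1\<close>, so scaling by
  \<open>2 ^ k\<close> turns the recurrence of \<open>dirichlet\<close> into that of
  \<open>lehmer\<close>.\<close>

lemma dirichlet_lehmer:
  assumes N: "N dvd 2 * y + 1"
  shows "N dvd 2 ^ k * dirichlet e y k - lehmer e k"
  using N
proof (induction e y k rule: dirichlet.induct)
  case (2 e y)
  then show ?case by (simp add: algebra_simps)
next
  case (3 e y k)
  have "2 ^ Suc (Suc k) * dirichlet e y (Suc (Suc k)) - lehmer e (Suc (Suc k)) =
      2 * y * (2 ^ Suc k * dirichlet e y (Suc k) - lehmer e (Suc k)) + (2 * y + 1) * lehmer e (Suc k)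
      - 4 * (2 ^ k * dirichlet e y k - lehmer e k)"
    by (simp add: algebra_simps)
  then show ?case
    using 3 by (metis dvd_add dvd_diff dvd_mult dvd_mult2)
qed simp

text \<open>\<open>N\<close> is odd, so \<open>2 ^ k\<close> cancels. Since \<open>y\<close> is
  absent on the right, \<open>bc\<close> and \<open>bac\<close> share one criterion.\<close>

lemma dvd_dirichlet_iff:
  assumes N: "N dvd 2 * y + 1"
  shows "N dvd dirichlet e y k \<longleftrightarrow> N dvd lehmer e k"
proof -
  have "coprime N (2 ^ k)"
  proof -
    have "odd N" using N by (metis dvd_trans even_mult_iff even_plus_one_iff even_numeral)
    then show ?thesis by simp
  qed
  then have "N dvd dirichlet e y k \<longleftrightarrow> N dvd 2 ^ k * dirichlet e y k"
    by (simp add: coprime_dvd_mult_right_iff)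
  also have "\<dots> \<longleftrightarrow> N dvd lehmer e k"
    using dirichlet_lehmer[OF N, of k e] by (metis dvd_diff_commute dvd_diff_right_iff)
  finally show ?thesis .
qed

text \<open>With \<open>y = z + 1/z\<close> the characteristic roots are \<open>1\<close>,
  \<open>z\<close>, \<open>1/z\<close>, and \<open>X^(2k+e) - 1\<close> agrees with
  \<open>dirichlet e y k * X^k (X^e - 1)\<close> at each of them.\<close>

lemma recurrence_shift:
  fixes s :: "nat \<Rightarrow> int"
  assumes rec: "\<And>n. s (n + 3) = (y + 1) * s (n + 2) - (y + 1) * s (n + 1) + s n"
    and e: "e \<in> {1, 2}"
  shows "s (n + 2 * k + e) - s n = dirichlet e y k * (s (n + k + e) - s (n + k))"
  using rec e
proof (induction e y k arbitrary: n rule: dirichlet.induct)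
  case (2 e y)
  show ?case
    using 2(2) 2(1)[of n] 2(1)[of "Suc n"] by (auto simp: eval_nat_numeral algebra_simps)
next
  case (3 e y k)
  \<comment> \<open>The factor \<open>X - 1\<close> makes this constant, so it cancels in
    differences.\<close>
  have const: "s (n + 2) - y * s (n + 1) + s n = s 2 - y * s 1 + s 0" for n
  proof (induction n)
    case (Suc n)
    then show ?case using 3(3)[of n] by (simp add: eval_nat_numeral algebra_simps)
  qed (simp add: eval_nat_numeral)
  have "s (n + 2 * Suc (Suc k) + e) - s n =
     y * (s (Suc n + 2 * Suc k + e) - s (Suc n)) - (s (n + 2 + 2 * k + e) - s (n + 2))"
    using const[of n] const[of "n + 2 * k + e + 2"] by (simp add: eval_nat_numeral algebra_simps)
  also have "s (Suc n + 2 * Suc k + e) - s (Suc n) =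
      dirichlet e y (Suc k) * (s (n + Suc (Suc k) + e) - s (n + Suc (Suc k)))"
    using 3(1)[OF 3(3,4), of "Suc n"] by simp
  also have "s (n + 2 + 2 * k + e) - s (n + 2) =
      dirichlet e y k * (s (n + Suc (Suc k) + e) - s (n + Suc (Suc k)))"
    using 3(2)[OF 3(3,4), of "n + 2"] by simp
  also have "y * (dirichlet e y (Suc k) * (s (n + Suc (Suc k) + e) - s (n + Suc (Suc k)))) -
      dirichlet e y k * (s (n + Suc (Suc k) + e) - s (n + Suc (Suc k))) =
      dirichlet e y (Suc (Suc k)) * (s (n + Suc (Suc k) + e) - s (n + Suc (Suc k)))"
    by (simp add: algebra_simps)
  finally show ?case .
qed simp


lemma sum_lessThan_mult:
  fixes F :: "nat \<Rightarrow> int"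
  shows "(\<Sum>i<m * n. F i) = (\<Sum>j<m. \<Sum>i<n. F (j * n + i))"
proof -
  have "sum F {j * n..<j * n + n} = (\<Sum>i<n. F (j * n + i))" for j
    using sum.shift_bounds_nat_ivl[of F 0 "j * n" n]
    by (simp add: add.commute atLeast0LessThan)
  then show ?thesis using sum.nat_group[of F n m] by simp
qed

section \<open>Actions modulo an equivalence\<close>

text \<open>
  The group \<open>H\<^sub>d\<close> acts on the quotient by \<open>E\<close>; only the involutions are required to be exact.
\<close>

locale H_action =
  fixes E :: "'x \<Rightarrow> 'x \<Rightarrow> bool" and A B C :: "'x \<Rightarrow> 'x" and d :: nat
  assumes E: "equivp E"
    and involution: "A (A v) = v" "B (B v) = v" "C (C v) = v"
    and cong: "E u v \<Longrightarrow> E (A u) (A v)" "E u v \<Longrightarrow> E (B u) (B v)" "E u v \<Longrightarrow> E (C u) (C v)"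
    and ab: "E (((A \<circ> B) ^^ 3) v) v"
    and ac: "E (((A \<circ> C) ^^ 2) v) v"
    and bc: "E (((B \<circ> C) ^^ d) v) v"
    and bac: "E (((B \<circ> A \<circ> C) ^^ d) v) v"
begin

lemma E_refl: "E v v"
  using E by (rule equivp_reflp)

lemma E_sym: "E u v \<Longrightarrow> E v u"
  using E by (rule equivp_symp)

lemma E_trans: "E u v \<Longrightarrow> E v w \<Longrightarrow> E u w"
  using E by (rule equivp_transp)

text \<open>The elements of the free group acting trivially modulo \<open>E\<close> form a normal
  subgroup that contains the relators of \<open>H\<^sub>d\<close>, hence their normal closure, in
  which \<open>(bc)^k\<close> lies by assumption.\<close>

lemma H_eq_imp_bc_power:
  assumes "H_eq d k"
  shows "E (((B \<circ> C) ^^ k) v) v"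
proof -
  let ?S = "{f. bij f \<and> (\<forall>u v. E (f u) (f v) \<longleftrightarrow> E u v)}"
  let ?P = "\<lparr>carrier = ?S, mult = (\<circ>), one = id\<rparr>"
  interpret P: group ?P
  proof (rule groupI)
    fix f assume f: "f \<in> carrier ?P"
    have "inv_into UNIV f \<in> carrier ?P"
      using f by (auto simp: bij_imp_bij_inv) (metis bij_inv_eq_iff)+
    moreover have "inv_into UNIV f \<circ> f = id"
      using f by (simp add: bij_is_inj)
    ultimately show "\<exists>g\<in>carrier ?P. g \<otimes>\<^bsub>?P\<^esub> f = \<one>\<^bsub>?P\<^esub>"
      by auto
  qed (auto simp: bij_comp)
  interpret F: group "free_group :: gen letter list monoid" by (rule group_free_group)
  define img where "img x = (case x of Gen_a \<Rightarrow> A | Gen_b \<Rightarrow> B | Gen_c \<Rightarrow> C)" for x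
  have "bij A" "bij B" "bij C"
    by (rule o_bij[of A] o_bij[of B] o_bij[of C]; simp add: fun_eq_iff involution)+
  moreover have "E (A u) (A v) \<longleftrightarrow> E u v" "E (B u) (B v) \<longleftrightarrow> E u v" "E (C u) (C v) \<longleftrightarrow> E u v" for u v
    using cong(1)[of "A u" "A v"] cong(2)[of "B u" "B v"] cong(3)[of "C u" "C v"]
    by (auto simp: involution intro: cong)
  ultimately have img: "img x \<in> carrier ?P" for x
    by (auto simp: img_def split: gen.split)
  from free_group_universal[of ?P img, OF P.group_axioms img]
  obtain h where h: "h \<in> hom free_group ?P" and h_gen: "\<And>x. h (free_gen x) = img x"
    by blast
  interpret h: group_hom free_group ?P h
    using h by unfold_locales
  have h_mult: "h (v \<otimes>\<^bsub>free_group\<^esub> w) = h v \<circ> h w"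
    if "v \<in> carrier free_group" "w \<in> carrier free_group" for v w
    using h.hom_mult[OF that] by simp
  have h_E: "E (h w u) (h w v) \<longleftrightarrow> E u v" if "w \<in> carrier free_group" for w u v
    using h.hom_closed[OF that] by simp
  have h_inv: "h w (h (inv\<^bsub>free_group\<^esub> w) u) = u" if w: "w \<in> carrier free_group" for w u
  proof -
    have "h w \<circ> h (inv\<^bsub>free_group\<^esub> w) = id"
      using h_mult[OF w F.inv_closed[OF w]] h.hom_one w by (simp add: F.r_inv)
    then show ?thesis by (metis comp_apply id_apply)
  qed
  have h_pow: "h (w [^]\<^bsub>free_group\<^esub> j) = h w ^^ j" if "w \<in> carrier free_group" for w and j :: nat
  proof (induction j)
    case 0
    then show ?case using h.hom_one by simp
  next
    case (Suc j)
    then show ?case using that by (simp add: h_mult funpow_Suc_right del: funpow.simps)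
  qed
  define K where "K = {w \<in> carrier free_group. \<forall>v. E (h w v) v}"
  have "K \<lhd> free_group"
    unfolding F.normal_inv_iff
  proof (intro conjI ballI)
    show "subgroup K free_group"
    proof
      show "K \<subseteq> carrier free_group" by (auto simp: K_def)
      show "\<one>\<^bsub>free_group\<^esub> \<in> K" using h.hom_one by (simp add: K_def E_refl)
    next
      fix x y assume "x \<in> K" "y \<in> K"
      then show "x \<otimes>\<^bsub>free_group\<^esub> y \<in> K"
        by (auto simp: K_def h_mult intro: E_trans)
    next
      fix x assume x: "x \<in> K"
      then have "E (h (inv\<^bsub>free_group\<^esub> x) v) v" for v
        using h_inv[of x v] E_sym by (metis (no_types, lifting) K_def mem_Collect_eq)
      then show "inv\<^bsub>free_group\<^esub> x \<in> K" using x by (simp add: K_def)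
    qed
  next
    fix x y :: "gen letter list"
    assume x: "x \<in> carrier free_group" and y: "y \<in> K"
    then have "E (h x (h y (h (inv\<^bsub>free_group\<^esub> x) v))) v" for v
      using h_E[OF x, of "h y (h (inv\<^bsub>free_group\<^esub> x) v)" "h (inv\<^bsub>free_group\<^esub> x) v"] h_inv[OF x, of v]
      by (simp add: K_def)
    then show "x \<otimes>\<^bsub>free_group\<^esub> y \<otimes>\<^bsub>free_group\<^esub> inv\<^bsub>free_group\<^esub> x \<in> K"
      using x y by (simp add: K_def h_mult)
  qed
  moreover have "H_relators d \<subseteq> K"
    using ab ac bc bac
    by (auto simp: H_relators_def Let_def K_def h_pow h_mult h_gen img_def E_refl involution
        numeral_2_eq_2)
  ultimately have "normal_closure free_group (H_relators d) \<subseteq> K"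
    by (auto simp: normal_closure_def)
  moreover have "(free_gen Gen_b \<otimes>\<^bsub>free_group\<^esub> free_gen Gen_c) [^]\<^bsub>free_group\<^esub> k
      \<in> normal_closure free_group (H_relators d)"
    using assms by (auto simp: H_eq_def normal_closure_def H_relators_def Let_def)
  ultimately show ?thesis
    by (auto simp: K_def h_pow h_mult h_gen img_def)
qed

definition fun_E :: "('x \<Rightarrow> 'x) \<Rightarrow> ('x \<Rightarrow> 'x) \<Rightarrow> bool" where
  "fun_E f g \<longleftrightarrow> (\<forall>v. E (f v) (g v))"

lemma fun_E_refl: "fun_E g g"
  by (simp add: fun_E_def E_refl)

lemma fun_E_sym: "fun_E f g \<Longrightarrow> fun_E g f"
  by (auto simp: fun_E_def intro: E_sym)

lemma fun_E_trans: "fun_E f g \<Longrightarrow> fun_E g h \<Longrightarrow> fun_E f h"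
  by (auto simp: fun_E_def intro: E_trans)

lemma fun_E_comp_right: "fun_E f g \<Longrightarrow> fun_E (f \<circ> h) (g \<circ> h)"
  by (simp add: fun_E_def)

lemma fun_E_comp_left:
  "fun_E f g \<Longrightarrow> fun_E (A \<circ> f) (A \<circ> g)"
  "fun_E f g \<Longrightarrow> fun_E (B \<circ> f) (B \<circ> g)"
  "fun_E f g \<Longrightarrow> fun_E (C \<circ> f) (C \<circ> g)"
  by (auto simp: fun_E_def intro: cong)

lemma involution_comp: "A \<circ> (A \<circ> g) = g" "B \<circ> (B \<circ> g) = g" "C \<circ> (C \<circ> g) = g"
  by (simp_all add: fun_eq_iff involution)

lemma A_C_commute: "fun_E (A \<circ> C) (C \<circ> A)"
proof -
  have "E (A (C v)) (C (A v))" for v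
    using ac[of "C (A v)"] by (simp add: numeral_2_eq_2 involution)
  then show ?thesis by (simp add: fun_E_def)
qed

lemma fun_E_power_mult:
  assumes "fun_E (f ^^ n) id"
  shows "fun_E (f ^^ (j * n)) id"
proof (induction j)
  case (Suc j)
  have "fun_E (f ^^ n \<circ> f ^^ (j * n)) (id \<circ> f ^^ (j * n))"
    using assms by (rule fun_E_comp_right)
  then have "fun_E (f ^^ (Suc j * n)) (f ^^ (j * n))"
    by (simp add: funpow_add)
  then show ?case using Suc by (rule fun_E_trans)
qed (simp add: fun_E_refl)

lemma fun_E_power_gcd:
  assumes "fun_E (f ^^ i) id" "fun_E (f ^^ n) id"
  shows "fun_E (f ^^ gcd i n) id"
proof (cases "i = 0")
  case True
  then show ?thesis using assms by simp
next
  case False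
  then obtain x y where xy: "i * x = n * y + gcd i n"
    using bezout_nat by blast
  have "fun_E (f ^^ (y * n) \<circ> f ^^ gcd i n) (id \<circ> f ^^ gcd i n)"
    by (intro fun_E_comp_right fun_E_power_mult assms)
  moreover have "f ^^ (y * n) \<circ> f ^^ gcd i n = f ^^ (x * i)"
    using xy by (simp add: funpow_add[symmetric] mult.commute)
  ultimately show ?thesis
    using fun_E_power_mult[OF assms(1), of x] by (metis fun_E_sym fun_E_trans id_comp)
qed

section \<open>The extension by crossing numbers\<close>

text \<open>
  View the group elements \<open>g\<close> as the flags of a map in which \<open>c\<close> crosses the edge of a flag.
  The cocycle below is the crossing number with the edge \<open>{1, a, c, ac}\<close>, whose two sides are
  \<open>{1, a}\<close> and \<open>{c, ac}\<close>. It vanishes on all relators not depending on \<open>d\<close>.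
\<close>

definition near :: "('x \<Rightarrow> 'x) \<Rightarrow> bool" where
  "near g \<longleftrightarrow> fun_E g id \<or> fun_E g A"

definition crossing :: "('x \<Rightarrow> 'x) \<Rightarrow> int" where
  "crossing g = of_bool (near g) - of_bool (near (C \<circ> g))"

lemma near_cong: "fun_E f g \<Longrightarrow> near f \<longleftrightarrow> near g"
  unfolding near_def by (meson fun_E_sym fun_E_trans)

lemma crossing_cong: "fun_E f g \<Longrightarrow> crossing f = crossing g"
  using near_cong[of f g] near_cong[of "C \<circ> f" "C \<circ> g"] fun_E_comp_left
  by (simp add: crossing_def)

lemma crossing_C: "crossing (C \<circ> g) = - crossing g"
  by (simp add: crossing_def involution_comp)

lemma near_A: "near (A \<circ> g) \<longleftrightarrow> near g"
proof -
  have "near (A \<circ> g)" if "near g" for g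
    using that fun_E_comp_left(1)[of g id] fun_E_comp_left(1)[of g A] involution_comp(1)[of id]
    by (auto simp: near_def)
  from this[of g] this[of "A \<circ> g"] show ?thesis by (auto simp: involution_comp)
qed

text \<open>\<open>A\<close> commutes with \<open>C\<close> modulo \<open>E\<close>, so it preserves
  both sides of the edge. With \<open>crossing_C\<close>, the two contributions to
  \<open>(ac)^2\<close> cancel.\<close>

lemma crossing_A: "crossing (A \<circ> g) = crossing g"
proof -
  have "near (C \<circ> (A \<circ> g)) \<longleftrightarrow> near (A \<circ> (C \<circ> g))"
    using fun_E_comp_right[OF A_C_commute, of g] by (intro near_cong) (simp add: comp_assoc fun_E_sym)
  then show ?thesis by (simp add: crossing_def near_A)
qed

definition lift_A :: "('x \<Rightarrow> 'x) \<times> int \<Rightarrow> ('x \<Rightarrow> 'x) \<times> int" where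
  "lift_A = (\<lambda>(g, t). (A \<circ> g, t))"

definition lift_B :: "('x \<Rightarrow> 'x) \<times> int \<Rightarrow> ('x \<Rightarrow> 'x) \<times> int" where
  "lift_B = (\<lambda>(g, t). (B \<circ> g, t))"

definition lift_C :: "('x \<Rightarrow> 'x) \<times> int \<Rightarrow> ('x \<Rightarrow> 'x) \<times> int" where
  "lift_C = (\<lambda>(g, t). (C \<circ> g, t + crossing g))"

text \<open>Integers are reduced modulo \<open>m\<close> only here, so the lifted involutions stay
  exact.\<close>

definition lift_E :: "nat \<Rightarrow> ('x \<Rightarrow> 'x) \<times> int \<Rightarrow> ('x \<Rightarrow> 'x) \<times> int \<Rightarrow> bool" where
  "lift_E m = (\<lambda>(g, t) (g', t'). fun_E g g' \<and> int m dvd t - t')"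

definition skew :: "('x \<Rightarrow> 'x) \<Rightarrow> ('x \<Rightarrow> 'x) \<times> int \<Rightarrow> ('x \<Rightarrow> 'x) \<times> int" where
  "skew f = (\<lambda>(g, t). (f \<circ> g, t + crossing g))"

lemma lift_BC: "lift_B \<circ> lift_C = skew (B \<circ> C)"
  and lift_BAC: "lift_B \<circ> lift_A \<circ> lift_C = skew (B \<circ> A \<circ> C)"
  by (auto simp: lift_A_def lift_B_def lift_C_def skew_def comp_assoc)

lemma skew_power: "(skew f ^^ j) (g, t) = (f ^^ j \<circ> g, t + (\<Sum>i<j. crossing (f ^^ i \<circ> g)))"
  by (induction j) (auto simp: skew_def comp_assoc)

text \<open>\<open>crossing\<close> is periodic along the orbit, so \<open>m\<close> periods add a
  multiple of \<open>m\<close>.\<close>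

lemma skew_power_period:
  assumes "fun_E (f ^^ n) id"
  shows "lift_E m ((skew f ^^ (m * n)) v) v"
proof -
  obtain g t where v: "v = (g, t)" by (cases v)
  have period: "fun_E (f ^^ (j * n) \<circ> h) h" for j h
    using fun_E_comp_right[OF fun_E_power_mult[OF assms], of j h] by simp
  have "crossing (f ^^ (j * n + i) \<circ> g) = crossing (f ^^ i \<circ> g)" for i j
    using crossing_cong[OF period[of j "f ^^ i \<circ> g"]] by (simp add: funpow_add comp_assoc)
  then have "(\<Sum>i<m * n. crossing (f ^^ i \<circ> g)) = int m * (\<Sum>i<n. crossing (f ^^ i \<circ> g))"
    by (simp add: sum_lessThan_mult)
  then show ?thesis
    using period[of m g] by (simp add: v skew_power lift_E_def)
qed

lemma H_action_lift: "H_action (lift_E m) lift_A lift_B lift_C (m * d)"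
proof
  show "equivp (lift_E m)"
  proof (rule equivpI)
    show "reflp (lift_E m)" by (auto simp: reflp_def lift_E_def fun_E_refl)
    show "symp (lift_E m)"
      by (auto simp: symp_def lift_E_def fun_E_sym dvd_diff_commute)
    show "transp (lift_E m)"
      unfolding transp_def lift_E_def
      by (auto intro: fun_E_trans) (metis diff_add_cancel add_diff_eq dvd_add)
  qed
  fix u v
  show "lift_A (lift_A v) = v" "lift_B (lift_B v) = v" "lift_C (lift_C v) = v"
    by (auto simp: lift_A_def lift_B_def lift_C_def involution_comp crossing_C split: prod.split)
  show "lift_E m u v \<Longrightarrow> lift_E m (lift_A u) (lift_A v)"
    "lift_E m u v \<Longrightarrow> lift_E m (lift_B u) (lift_B v)"
    "lift_E m u v \<Longrightarrow> lift_E m (lift_C u) (lift_C v)"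
    by (auto simp: lift_E_def lift_A_def lift_B_def lift_C_def fun_E_comp_left
        dest: crossing_cong split: prod.splits)
  obtain g t where v: "v = (g, t)" by (cases v)
  show "lift_E m (((lift_A \<circ> lift_B) ^^ 3) v) v"
    using ab by (simp add: v lift_A_def lift_B_def lift_E_def fun_E_def numeral_3_eq_3)
  have "t + crossing g + crossing (A \<circ> (C \<circ> g)) = t"
    by (simp add: crossing_A crossing_C)
  then show "lift_E m (((lift_A \<circ> lift_C) ^^ 2) v) v"
    using ac by (simp add: v lift_A_def lift_C_def lift_E_def fun_E_def numeral_2_eq_2)
  show "lift_E m (((lift_B \<circ> lift_C) ^^ (m * d)) v) v"
    unfolding lift_BC using bc by (intro skew_power_period) (simp add: fun_E_def)
  show "lift_E m (((lift_B \<circ> lift_A \<circ> lift_C) ^^ (m * d)) v) v"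
    unfolding lift_BAC using bac by (intro skew_power_period) (simp add: fun_E_def)
qed

text \<open>By \<open>not_power\<close>, a power of \<open>bc\<close> meets the edge only if it is
  trivial, so \<open>(bc)^i\<close> has crossing number \<open>1\<close> if \<open>d\<close> divides
  \<open>i\<close> and \<open>0\<close> otherwise. Over \<open>k = q d\<close> steps these add up to
  \<open>q\<close>, which must vanish modulo \<open>m\<close>.\<close>

lemma bc_order_multiple:
  assumes "d > 0"
    and order: "\<And>i. fun_E ((B \<circ> C) ^^ i) id \<Longrightarrow> d dvd i"
    and not_power: "\<And>i. \<not> fun_E ((B \<circ> C) ^^ i) A" "\<And>i. \<not> fun_E ((B \<circ> C) ^^ i) C"
      "\<And>i. \<not> fun_E ((B \<circ> C) ^^ i) (C \<circ> A)"
    and "H_eq (m * d) k"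
  shows "m * d dvd k"
proof -
  have "fun_E ((B \<circ> C) ^^ (j * d)) id" for j
    by (rule fun_E_power_mult) (simp add: fun_E_def bc)
  with order have "near ((B \<circ> C) ^^ i) \<longleftrightarrow> d dvd i" for i
    using not_power(1)[of i] by (auto simp: near_def mult.commute)
  moreover have "\<not> near (C \<circ> (B \<circ> C) ^^ i)" for i
    using not_power(2,3)[of i] fun_E_comp_left(3)[of "C \<circ> (B \<circ> C) ^^ i" id]
      fun_E_comp_left(3)[of "C \<circ> (B \<circ> C) ^^ i" A] by (auto simp: near_def involution_comp)
  ultimately have crossing: "crossing ((B \<circ> C) ^^ i) = of_bool (d dvd i)" for i
    by (simp add: crossing_def)
  interpret L: H_action "lift_E m" lift_A lift_B lift_C "m * d"
    by (rule H_action_lift)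
  have "lift_E m ((skew (B \<circ> C) ^^ k) (id, 0)) (id, 0)"
    using L.H_eq_imp_bc_power[OF \<open>H_eq (m * d) k\<close>] by (simp add: lift_BC)
  then have id: "fun_E ((B \<circ> C) ^^ k) id"
    and m: "int m dvd (\<Sum>i<k. crossing ((B \<circ> C) ^^ i))"
    by (simp_all add: skew_power lift_E_def)
  obtain q where k: "k = q * d"
    using order[OF id] by (metis dvd_def mult.commute)
  have "(\<Sum>i<d. of_bool (d dvd j * d + i)) = (1::int)" for j
  proof -
    have "of_bool (d dvd j * d + i) = (if i = 0 then 1 else 0 :: int)" if "i < d" for i
      using that by (auto dest: dvd_imp_le)
    then have "(\<Sum>i<d. of_bool (d dvd j * d + i)) = (\<Sum>i<d. if i = 0 then 1 else 0 :: int)"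
      by (intro sum.cong) auto
    then show ?thesis using \<open>d > 0\<close> by simp
  qed
  then have "(\<Sum>i<k. crossing ((B \<circ> C) ^^ i)) = int q"
    by (simp add: k crossing sum_lessThan_mult)
  with m show ?thesis by (simp add: k)
qed

end

section \<open>The matrix action modulo \<open>N\<close>\<close>

text \<open>
  Up to sign, \<open>a\<close> and \<open>b\<close> are the reflections in the first two basis vectors, whose product has
  order \<open>3\<close>, and \<open>c\<close> exchanges the second and third one. The sign makes \<open>bac\<close> have
  eigenvalue \<open>1\<close> instead of \<open>- 1\<close>.
\<close>

definition refl_a :: "int \<times> int \<times> int \<Rightarrow> int \<times> int \<times> int" where
  "refl_a = (\<lambda>(p, q, r). (p - q - r, - q, - r))"

definition refl_b :: "int \<Rightarrow> int \<times> int \<times> int \<Rightarrow> int \<times> int \<times> int" where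
  "refl_b x = (\<lambda>(p, q, r). (- p, q - p - x * r, - r))"

definition refl_c :: "int \<times> int \<times> int \<Rightarrow> int \<times> int \<times> int" where
  "refl_c = (\<lambda>(p, q, r). (- p, - r, - q))"

definition cong3 :: "int \<Rightarrow> int \<times> int \<times> int \<Rightarrow> int \<times> int \<times> int \<Rightarrow> bool" where
  "cong3 N = (\<lambda>(p, q, r) (p', q', r'). N dvd p - p' \<and> N dvd q - q' \<and> N dvd r - r')"

lemma equivp_cong3: "equivp (cong3 N)"
proof (rule equivpI)
  show "reflp (cong3 N)" by (auto simp: reflp_def cong3_def)
  show "symp (cong3 N)" by (auto simp: symp_def cong3_def dvd_diff_commute)
  show "transp (cong3 N)"
    unfolding transp_def cong3_def by (auto simp: mod_eq_dvd_iff[symmetric])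
qed

text \<open>The assumption \<open>rec\<close> is Cayley-Hamilton, read off in each
  coordinate.\<close>

lemma cong3_power_dirichlet:
  assumes rec: "\<And>\<pi> v. \<pi> \<in> {fst, fst \<circ> snd, snd \<circ> snd} \<Longrightarrow>
      \<pi> (f (f (f v))) = (y + 1) * \<pi> (f (f v)) - (y + 1) * \<pi> (f v) + \<pi> v"
    and e: "e \<in> {1, 2}" and N: "N dvd dirichlet e y k"
  shows "cong3 N ((f ^^ (2 * k + e)) v) v"
proof -
  have rec': "\<pi> ((f ^^ (n + 3)) v) =
      (y + 1) * \<pi> ((f ^^ (n + 2)) v) - (y + 1) * \<pi> ((f ^^ (n + 1)) v) + \<pi> ((f ^^ n) v)"
    if "\<pi> \<in> {fst, fst \<circ> snd, snd \<circ> snd}" for \<pi> n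
    using rec[OF that, of "(f ^^ n) v"] by (simp add: numeral_3_eq_3)
  have "N dvd \<pi> ((f ^^ (2 * k + e)) v) - \<pi> v" if "\<pi> \<in> {fst, fst \<circ> snd, snd \<circ> snd}" for \<pi>
    using recurrence_shift[OF rec'[OF that] e, of 0 k] N by simp
  from this[of fst] this[of "fst \<circ> snd"] this[of "snd \<circ> snd"] show ?thesis
    by (simp add: cong3_def case_prod_unfold)
qed

lemma refl_bc: "refl_b x (refl_c (p, q, r)) = (p, p + x * q - r, q)"
  by (simp add: refl_b_def refl_c_def)

lemma refl_bac: "refl_b x (refl_a (refl_c (p, q, r))) = (p - q - r, p - q - x * q, - q)"
  by (simp add: refl_a_def refl_b_def refl_c_def algebra_simps)

lemma H_action_refl:
  assumes e: "e \<in> {1, 2}" and N: "N dvd lehmer e k" "N = 2 * x + 1"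
  shows "H_action (cong3 N) refl_a (refl_b x) refl_c (2 * k + e)"
proof
  show "equivp (cong3 N)" by (rule equivp_cong3)
  fix u v :: "int \<times> int \<times> int"
  obtain p q r where v: "v = (p, q, r)" by (cases v)
  obtain p' q' r' where u: "u = (p', q', r')" by (cases u)
  show "refl_a (refl_a v) = v" "refl_b x (refl_b x v) = v" "refl_c (refl_c v) = v"
    by (simp_all add: v refl_a_def refl_b_def refl_c_def)
  show "cong3 N u v \<Longrightarrow> cong3 N (refl_a u) (refl_a v)"
    "cong3 N u v \<Longrightarrow> cong3 N (refl_b x u) (refl_b x v)"
    "cong3 N u v \<Longrightarrow> cong3 N (refl_c u) (refl_c v)"
    by (auto simp: u v cong3_def refl_a_def refl_b_def refl_c_def mod_eq_dvd_iff[symmetric]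
        intro!: mod_diff_cong mod_minus_cong mod_mult_cong)
  show "cong3 N (((refl_a \<circ> refl_b x) ^^ 3) v) v"
    by (simp add: v refl_a_def refl_b_def cong3_def numeral_3_eq_3 algebra_simps)
  show "cong3 N (((refl_a \<circ> refl_c) ^^ 2) v) v"
    by (simp add: v refl_a_def refl_c_def cong3_def numeral_2_eq_2 algebra_simps)
  have "N dvd dirichlet e x k"
    using dvd_dirichlet_iff[of N x e k] N by simp
  then show "cong3 N (((refl_b x \<circ> refl_c) ^^ (2 * k + e)) v) v"
    using e by (intro cong3_power_dirichlet[where y = x]) (auto simp: refl_bc algebra_simps)
  \<comment> \<open>Over the integers \<open>bac\<close> has parameter \<open>- 1 - x\<close>, which
    is \<open>x\<close> modulo \<open>N\<close>.\<close>
  have "N dvd 2 * (- 1 - x) + 1"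
    unfolding N(2) by (rule dvdI[of _ _ "-1"]) simp
  then have "N dvd dirichlet e (- 1 - x) k"
    using dvd_dirichlet_iff[of N "- 1 - x" e k] N by simp
  then show "cong3 N (((refl_b x \<circ> refl_a \<circ> refl_c) ^^ (2 * k + e)) v) v"
    using e by (intro cong3_power_dirichlet[where y = "- 1 - x"])
      (auto simp: refl_bac algebra_simps)
qed

text \<open>This invariant separates the powers of \<open>bc\<close> from \<open>a\<close>,
  \<open>c\<close> and \<open>ca\<close>.\<close>

lemma fst_refl_bc_power: "fst (((refl_b x \<circ> refl_c) ^^ i) v) = fst v"
  by (induction i) (auto simp: refl_b_def refl_c_def split: prod.split)

text \<open>The third coordinate along the orbit of \<open>(1, 0, 0)\<close> starts
  \<open>0, 0, 1\<close>, so at a suitable index the cofactor of \<open>dirichlet\<close> in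
  \<open>recurrence_shift\<close> is \<open>1\<close> modulo \<open>N\<close>.\<close>

lemma lehmer_of_period:
  assumes e: "e \<in> {1, 2}" and N: "N = 2 * x + 1"
    and period: "\<And>v. cong3 N (((refl_b x \<circ> refl_c) ^^ (2 * k + e)) v) v"
  shows "N dvd lehmer e k"
proof -
  let ?M = "refl_b x \<circ> refl_c"
  define s where "s n = snd (snd ((?M ^^ n) (1, 0, 0)))" for n
  have s012: "s 0 = 0" "s (Suc 0) = 0" "s 2 = 1"
    by (simp_all add: s_def refl_bc numeral_2_eq_2)
  have rec: "s (n + 3) = (x + 1) * s (n + 2) - (x + 1) * s (n + 1) + s n" for n
  proof -
    obtain p q r where "(?M ^^ n) (1, 0, 0) = (p, q, r)" by (cases "(?M ^^ n) (1, 0, 0)")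
    then show ?thesis
      by (simp add: s_def numeral_3_eq_3 refl_bc algebra_simps)
  qed
  let ?D = "2 * k + e"
  have s_period: "N dvd s (?D + n) - s n" for n
    using period[of "(?M ^^ n) (1, 0, 0)"]
    by (auto simp: s_def funpow_add cong3_def split: prod.splits)
  \<comment> \<open>The added period \<open>?D\<close> keeps the subtraction of \<open>k\<close>
    exact without changing residues.\<close>
  define n where "n = ?D + (2 - e) - k"
  have n: "n + k + e = ?D + 2" "n + k = ?D + (2 - e)" using e by (auto simp: n_def)
  have "s (?D + n) - s n = dirichlet e x k * (s (?D + 2) - s (?D + (2 - e)))"
  proof -
    have D: "n + 2 * k + e = ?D + n" by simp
    show ?thesis
      using recurrence_shift[where s = s, OF rec e, of n k] unfolding n(1) D unfolding n(2) .
  qed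
  moreover have "N dvd (s (?D + 2) - s (?D + (2 - e))) - 1"
  proof -
    have "s (2 - e) = 0" using e by (auto simp: s012)
    then have "(s (?D + 2) - s (?D + (2 - e))) - 1 =
        (s (?D + 2) - s 2) - (s (?D + (2 - e)) - s (2 - e))"
      by (simp add: s012)
    then show ?thesis using s_period by (metis dvd_diff)
  qed
  ultimately have "N dvd dirichlet e x k"
    using s_period[of n] by (metis dvd_diff_right_iff dvd_mult mult.right_neutral right_diff_distrib)
  then show ?thesis
    using dvd_dirichlet_iff[of N x e k] N by simp
qed

text \<open>For even \<open>d\<close> the proper divisor \<open>d / 2\<close> is \<open>3\<close>,
  \<open>4\<close> or \<open>7\<close>, with Lehmer numbers \<open>- 3\<close>, \<open>7\<close>,
  \<open>13\<close>.\<close>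

lemma minimal_abs_lehmer_gt_1:
  assumes "d \<ge> 5" "d \<noteq> 7" and divisors: "\<And>j. j dvd d \<Longrightarrow> j < d \<Longrightarrow> j < 5 \<or> j = 7"
  obtains e k where "e \<in> {1, 2}" "d = 2 * k + e" "\<bar>lehmer e k\<bar> > 1"
proof (cases "odd d")
  case True
  then obtain k where k: "d = 2 * k + 1" by (rule oddE)
  with assms have "\<bar>lehmer 1 k\<bar> > 1" by (intro abs_lehmer_1_gt_1) auto
  with k that[of 1 k] show ?thesis by simp
next
  case False
  then obtain j where j: "d = 2 * j" by (auto elim: evenE)
  with divisors[of j] assms have "j < 5 \<or> j = 7" by simp
  moreover have "j \<ge> 3" using j assms(1) by simp
  ultimately have "j \<in> {3, 4, 7}" by auto
  then have "\<bar>lehmer 2 (j - 1)\<bar> > 1"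
    by (auto simp: eval_nat_numeral)
  with j assms that[of 2 "j - 1"] show ?thesis by simp
qed

section \<open>Reduction to a minimal divisor\<close>

theorem theorem6p18:
  fixes d :: nat
  assumes "d \<ge> 5" and "d \<noteq> 7"
  shows "H_uncollapsed d"
  unfolding H_uncollapsed_def
proof (intro allI impI notI)
  fix k assume k: "1 \<le> k \<and> k < d" and "H_eq d k"
  \<comment> \<open>Proper divisors of \<open>c\<close> lie in \<open>{1, 2, 3, 4, 7}\<close>, where
    the Lehmer numbers are units.\<close>
  define c where "c = (LEAST c. c dvd d \<and> c \<ge> 5 \<and> c \<noteq> 7)"
  have c: "c dvd d \<and> c \<ge> 5 \<and> c \<noteq> 7"
    unfolding c_def by (rule LeastI[of _ d]) (simp add: assms)
  have divisors: "j < 5 \<or> j = 7" if "j dvd c" "j < c" for j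
    using not_less_Least[of j "\<lambda>c. c dvd d \<and> c \<ge> 5 \<and> c \<noteq> 7"] that c dvd_trans
    by (fastforce simp: c_def[symmetric])
  obtain e l where e: "e \<in> {1, 2}" and c_eq: "c = 2 * l + e" and l: "\<bar>lehmer e l\<bar> > 1"
    using minimal_abs_lehmer_gt_1 c divisors by metis
  define N where "N = \<bar>lehmer e l\<bar>"
  define x where "x = N div 2"
  have "odd N" by (simp add: N_def odd_lehmer)
  then have N: "N = 2 * x + 1" "N > 1" "N dvd lehmer e l"
    using l by (simp_all add: x_def N_def)
  interpret H_action "cong3 N" refl_a "refl_b x" refl_c c
    unfolding c_eq using e N by (intro H_action_refl) simp_all
  have no_period: "\<not> fun_E ((refl_b x \<circ> refl_c) ^^ j) id" if j: "j < 5 \<or> j = 7" "j > 0" for j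
  proof
    assume *: "fun_E ((refl_b x \<circ> refl_c) ^^ j) id"
    have "j \<in> {1, 2, 3, 4, 7}" using j by auto
    then obtain e' k' where "e' \<in> {1, 2}" "j = 2 * k' + e'" "\<bar>lehmer e' k'\<bar> = 1"
    proof (elim insertE emptyE)
      assume "j = 1" then show thesis by (intro that[of 1 0]) simp_all
    next
      assume "j = 2" then show thesis by (intro that[of 2 0]) simp_all
    next
      assume "j = 3" then show thesis by (intro that[of 1 1]) simp_all
    next
      assume "j = 4" then show thesis by (intro that[of 2 1]) simp_all
    next
      assume "j = 7" then show thesis by (intro that[of 1 3]) (simp_all add: eval_nat_numeral)
    qed
    note e' = this
    have "cong3 N (((refl_b x \<circ> refl_c) ^^ (2 * k' + e')) v) v" for v
      using * by (cases v) (simp add: fun_E_def e'(2)[symmetric])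
    with e'(1) N(1) have "N dvd lehmer e' k'"
      by (rule lehmer_of_period)
    with e'(3) N(2) show False
      by (metis abs_dvd_iff dvd_abs_iff zdvd_not_zless zero_less_one)
  qed
  obtain m where d: "d = m * c" using c by (metis dvd_def mult.commute)
  have "m * c dvd k"
  proof (rule bc_order_multiple)
    show "c > 0" using c by simp
    show "H_eq (m * c) k" using \<open>H_eq d k\<close> d by simp
    \<comment> \<open>First coordinates will differ by \<open>1\<close> or \<open>2\<close>;
      \<open>N\<close> is odd and exceeds \<open>1\<close>.\<close>
    have not_dvd: "\<not> N dvd 1" "\<not> N dvd 2"
      using N by (auto dest: zdvd_imp_le)
    have fst_dvd: "N dvd fst v - fst (g v)" if "fun_E ((refl_b x \<circ> refl_c) ^^ i) g" for i g v
    proof -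
      have "cong3 N (((refl_b x \<circ> refl_c) ^^ i) v) (g v)"
        using that unfolding fun_E_def by blast
      then show ?thesis
        using fst_refl_bc_power[of i x v] by (simp add: cong3_def case_prod_unfold)
    qed
    show "\<not> fun_E ((refl_b x \<circ> refl_c) ^^ i) refl_a" for i
      using fst_dvd[of i refl_a "(0, 1, 0)"] not_dvd by (auto simp: refl_a_def)
    show "\<not> fun_E ((refl_b x \<circ> refl_c) ^^ i) refl_c" for i
      using fst_dvd[of i refl_c "(1, 0, 0)"] not_dvd by (auto simp: refl_c_def)
    show "\<not> fun_E ((refl_b x \<circ> refl_c) ^^ i) (refl_c \<circ> refl_a)" for i
      using fst_dvd[of i "refl_c \<circ> refl_a" "(1, 0, 0)"] not_dvd
      by (auto simp: refl_a_def refl_c_def)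
  next
    fix i assume "fun_E ((refl_b x \<circ> refl_c) ^^ i) id"
    then have "fun_E ((refl_b x \<circ> refl_c) ^^ gcd i c) id"
      by (rule fun_E_power_gcd) (simp add: fun_E_def bc)
    with no_period[of "gcd i c"] divisors[of "gcd i c"] c have "\<not> gcd i c < c"
      by auto
    moreover have "gcd i c \<le> c" using c by (intro dvd_imp_le) auto
    ultimately show "c dvd i" by (metis gcd_dvd1 le_neq_implies_less)
  qed
  with d k show False by (auto dest: dvd_imp_le)
qed

end
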